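(* Let $\beta>1$ be a real number. Then the Daroczy entropy $$H_\beta(p_1,\dots,p_n)=\frac{1}{1-2^{1-\beta}}\Big(1-\sum_{i=1}^n p_i^\beta\Big),\qquad (p_1,\dots,p_n)\in\Omega_n,\ n\ge1,$$ is an upper entropy function.
   Context: For each integer $N\ge 1$ let $\Omega_N=\{(p_1,\dots,p_N): p_i\ge 0,\ \sum_{i=1}^N p_i=1\}$, and let $\Omega=\bigcup_{N\ge1}\Omega_N$. A function $H:\Omega\to\mathbb{R}$ is called an upper entropy function if it satisfies: (i) Continuity: the restriction of $H$ to each $\Omega_N$ is continuous, and $H(p_1,\dots,p_N)=0$ if and only if there is $k$ with $p_k=1$. (ii) Symmetry: $H(p_1,\dots,p_N)$ is invariant under permutations of its arguments. (iii) Increasing property: if $(p_1,\dots,p_N)\in\Omega_N$, $1\le n\le N$, $m\ge1$, $q_1,\dots,q_m\ge 0$ and $p_n=\sum_{i=1}^m q_i$, then $$0\le H(p_1,\dots,p_{n-1},q_1,\dots,q_m,p_{n+1},\dots,p_N)-H(p_1,\dots,p_N)\le p_n H\Big(\frac{q_1}{p_n},\dots,\frac{q_m}{p_n}\Big),$$ where the right-hand side is read as $0$ when $p_n=0$. (iv) Maximum: for every $N\ge1$ and $(p_1,\dots,p_N)\in\Omega_N$, $H(p_1,\dots,p_N)\le H(\frac1N,\dots,\frac1N)$. *)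

theory Defs
  imports "HOL-Analysis.Analysis" "HOL-Combinatorics.Permutations"
begin

(* Points of the disjoint union of the simplices Omega N are lists; the list index is
   0-based, so p_i corresponds to p ! (i - 1). *)

definition Omega :: "nat \<Rightarrow> real list set" where
  "Omega N = {p. length p = N \<and> (\<forall>x\<in>set p. 0 \<le> x) \<and> sum_list p = 1}"

(* Lists carry no topology. The simplex Omega N gets its topology from the library's
   R^N, Euclidean_space N, whose points are the sequences vanishing from index N on;
   such a sequence f is identified with the list [f 0, ..., f (N - 1)]. *)

definition continuous_on_Omega :: "nat \<Rightarrow> (real list \<Rightarrow> real) \<Rightarrow> bool" where
  "continuous_on_Omega N H \<longleftrightarrow>
     continuous_map (subtopology (Euclidean_space N) {f. map f [0..<N] \<in> Omega N}) euclideanreal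
       (\<lambda>f. H (map f [0..<N]))"

definition entropy_continuity :: "(real list \<Rightarrow> real) \<Rightarrow> bool" where
  "entropy_continuity H \<longleftrightarrow>
     (\<forall>N\<ge>1. continuous_on_Omega N H \<and>
        (\<forall>p\<in>Omega N. H p = 0 \<longleftrightarrow> (\<exists>k<N. p ! k = 1)))"

definition entropy_symmetry :: "(real list \<Rightarrow> real) \<Rightarrow> bool" where
  "entropy_symmetry H \<longleftrightarrow>
     (\<forall>N\<ge>1. \<forall>p\<in>Omega N. \<forall>\<pi>. \<pi> permutes {..<N} \<longrightarrow> H (permute_list \<pi> p) = H p)"

definition entropy_increasing :: "(real list \<Rightarrow> real) \<Rightarrow> bool" where
  "entropy_increasing H \<longleftrightarrow>
     (\<forall>N\<ge>1. \<forall>p\<in>Omega N. \<forall>n<N. \<forall>q.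
        length q \<ge> 1 \<and> (\<forall>x\<in>set q. 0 \<le> x) \<and> p ! n = sum_list q \<longrightarrow>
        0 \<le> H (take n p @ q @ drop (Suc n) p) - H p \<and>
        H (take n p @ q @ drop (Suc n) p) - H p
          \<le> (if p ! n = 0 then 0 else p ! n * H (map (\<lambda>x. x / p ! n) q)))"

definition entropy_maximum :: "(real list \<Rightarrow> real) \<Rightarrow> bool" where
  "entropy_maximum H \<longleftrightarrow>
     (\<forall>N\<ge>1. \<forall>p\<in>Omega N. H p \<le> H (replicate N (1 / real N)))"

(* H is total on lists, but every condition only involves its values on the simplices. *)

definition upper_entropy_function :: "(real list \<Rightarrow> real) \<Rightarrow> bool" where
  "upper_entropy_function H \<longleftrightarrow>
     entropy_continuity H \<and> entropy_symmetry H \<and> entropy_increasing H \<and> entropy_maximum H"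

definition daroczy_entropy :: "real \<Rightarrow> real list \<Rightarrow> real" where
  "daroczy_entropy \<beta> p =
     1 / (1 - 2 powr (1 - \<beta>)) * (1 - (\<Sum>i<length p. (p ! i) powr \<beta>))"

end

theory Submission
  imports Defs
begin

text \<open>
  Up to the positive factor $1/(1-2^{1-\beta})$ the entropy is $1 - S(p)$ for the power sum
  $S(p) = \sum_i p_i^\beta$, so each condition is a statement about $S$.

  All of them rest on two elementary facts about $x \mapsto x^\beta$ with $\beta > 1$.
  On $[0,1]$ one has $x^\beta \le x$, with equality only at the end points. Hence $S(p) \le 1$ on
  the simplex, with equality only at its vertices, which gives the zeros of the entropy.
  Scaling by the total mass $r$ makes $S(q) \le r^\beta$ for every nonnegative $q$ of sum $r$,
  and this says that splitting a probability does not lower the entropy. Splitting $r$ into $q$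
  changes $S$ by exactly $-r^\beta (1 - S(q/r))$, and $r^\beta \le r$ then gives the upper bound
  of the increasing property.
  Secondly, $x^\beta$ lies above its tangent at $1/N$; summed over the simplex the linear terms
  cancel, which bounds $S$ below by its value at the uniform distribution.
\<close>

section \<open>Power sums of nonnegative lists\<close>

definition power_sum :: "real \<Rightarrow> real list \<Rightarrow> real" where
  "power_sum \<beta> p = (\<Sum>x\<leftarrow>p. x powr \<beta>)"

lemma power_sum_append [simp]: "power_sum \<beta> (p @ q) = power_sum \<beta> p + power_sum \<beta> q"
  by (simp add: power_sum_def)

lemma power_sum_Cons [simp]: "power_sum \<beta> (x # p) = x powr \<beta> + power_sum \<beta> p"
  by (simp add: power_sum_def)

lemma daroczy_entropy_power_sum:
  "daroczy_entropy \<beta> p = 1 / (1 - 2 powr (1 - \<beta>)) * (1 - power_sum \<beta> p)"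
  by (simp add: daroczy_entropy_def power_sum_def sum_list_sum_nth atLeast0LessThan)

lemma daroczy_factor_pos:
  fixes \<beta> :: real
  assumes "\<beta> > 1"
  shows "0 < 1 / (1 - 2 powr (1 - \<beta>))"
  using powr_less_mono[of "1 - \<beta>" 0 2] assms by simp

lemma powr_le_self:
  fixes x \<beta> :: real
  assumes "\<beta> \<ge> 1" "0 \<le> x" "x \<le> 1"
  shows "x powr \<beta> \<le> x"
  using powr_mono'[of 1 \<beta> x] assms by simp

lemma member_le_sum_list_nonneg:
  fixes p :: "real list"
  assumes "\<forall>x\<in>set p. 0 \<le> x" "x \<in> set p"
  shows "x \<le> sum_list p"
  using assms by (induction p) (auto intro: add_increasing add_increasing2 sum_list_nonneg)

lemma power_sum_le_sum_list:
  assumes "\<beta> \<ge> 1" "\<forall>x\<in>set p. 0 \<le> x \<and> x \<le> 1"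
  shows "power_sum \<beta> p \<le> sum_list p"
  using assms by (induction p) (auto simp: power_sum_def intro!: add_mono powr_le_self)

text \<open>Every gap $x - x^\beta$ is nonnegative, so a vanishing total gap makes each entry a fixed
  point of $x \mapsto x^\beta$.\<close>

lemma power_sum_eq_sum_list_imp_01:
  assumes "\<beta> > 1" "\<forall>x\<in>set p. 0 \<le> x \<and> x \<le> 1" "power_sum \<beta> p = sum_list p"
  shows "\<forall>x\<in>set p. x = 0 \<or> x = 1"
  using assms(2,3)
proof (induction p)
  case Nil
  then show ?case by simp
next
  case (Cons a p)
  have "a powr \<beta> \<le> a" "power_sum \<beta> p \<le> sum_list p"
    using Cons.prems(1) assms(1) by (auto intro!: powr_le_self power_sum_le_sum_list)
  with Cons.prems(2) have eqs: "a powr \<beta> = a" "power_sum \<beta> p = sum_list p"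
    by auto
  have "a = 0 \<or> a = 1"
    using powr_less_mono'[of a 1 \<beta>] eqs(1) Cons.prems(1) assms(1) by fastforce
  with Cons.IH eqs(2) Cons.prems(1) show ?case by simp
qed

lemma power_sum_scale:
  assumes "r > 0" "\<forall>x\<in>set q. 0 \<le> x"
  shows "power_sum \<beta> q = r powr \<beta> * power_sum \<beta> (map (\<lambda>x. x / r) q)"
  using assms by (induction q) (auto simp: power_sum_def powr_divide algebra_simps)

lemma power_sum_normalized_le_1:
  assumes "\<beta> \<ge> 1" "\<forall>x\<in>set q. 0 \<le> x" "sum_list q > 0"
  shows "power_sum \<beta> (map (\<lambda>x. x / sum_list q) q) \<le> 1"
proof -
  have "power_sum \<beta> (map (\<lambda>x. x / sum_list q) q) \<le> sum_list (map (\<lambda>x. x / sum_list q) q)"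
    using assms by (intro power_sum_le_sum_list) (auto simp: member_le_sum_list_nonneg)
  also have "\<dots> = 1"
    using assms(3) sum_list_mult_const[of "\<lambda>x. x" "1 / sum_list q" q] by simp
  finally show ?thesis .
qed

text \<open>The tangent of $t^\beta$ at $1$. Writing $t^\beta = t \exp((\beta - 1)\ln t)$, it follows
  from $\exp s \ge 1 + s$ and $\ln t \ge 1 - 1/t$.\<close>

lemma Bernoulli_inequality_powr:
  fixes t \<beta> :: real
  assumes "\<beta> \<ge> 1" "t \<ge> 0"
  shows "1 + \<beta> * (t - 1) \<le> t powr \<beta>"
proof (cases "t = 0")
  case True
  then show ?thesis using assms by simp
next
  case False
  with assms have t: "t > 0" by simp
  have ln: "1 - 1 / t \<le> ln t"
    using ln_le_minus_one[of "1 / t"] t by (simp add: ln_div)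
  have "1 + \<beta> * (t - 1) = t * (1 + (\<beta> - 1) * (1 - 1 / t))"
    using t by (simp add: field_simps)
  also have "\<dots> \<le> t * (1 + (\<beta> - 1) * ln t)"
    using t assms ln by (intro mult_left_mono add_left_mono) auto
  also have "\<dots> \<le> t * exp ((\<beta> - 1) * ln t)"
    using t by (intro mult_left_mono) auto
  also have "\<dots> = t powr \<beta>"
    using t by (simp add: powr_def left_diff_distrib exp_diff)
  finally show ?thesis .
qed

text \<open>By homogeneity the tangent at $1$ becomes the tangent at $c$. When $c$ is the mean of the
  entries, the term with $\beta$ as a factor vanishes and a constant list attains the bound.\<close>

lemma power_sum_tangent_bound:
  assumes "\<beta> \<ge> 1" "c > 0" "\<forall>x\<in>set p. 0 \<le> x"
  shows "c powr \<beta> * (real (length p) + \<beta> * (sum_list p / c - real (length p))) \<le> power_sum \<beta> p"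
  using assms(3)
proof (induction p)
  case Nil
  then show ?case by (simp add: power_sum_def)
next
  case (Cons a p)
  have "c powr \<beta> * (1 + \<beta> * (a / c - 1)) \<le> c powr \<beta> * (a / c) powr \<beta>"
    using Cons.prems assms by (intro mult_left_mono Bernoulli_inequality_powr) auto
  also have "\<dots> = a powr \<beta>"
    using Cons.prems assms(2) by (simp add: powr_divide)
  finally show ?case
    using Cons by (simp add: algebra_simps add_divide_distrib)
qed

section \<open>The conditions of an upper entropy function\<close>

lemma Omega_bounds:
  assumes "p \<in> Omega N"
  shows "\<forall>x\<in>set p. 0 \<le> x \<and> x \<le> 1"
  using assms member_le_sum_list_nonneg[of p] by (auto simp: Omega_def)

text \<open>For coordinates that may vanish, $x^\beta$ is continuous because $\beta > 0$; negative
  coordinates do not occur on the simplex.\<close>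

lemma daroczy_continuous:
  assumes "\<beta> > 0"
  shows "continuous_on_Omega N (daroczy_entropy \<beta>)"
proof -
  define X where "X = subtopology (Euclidean_space N) {f. map f [0..<N] \<in> Omega N}"
  have coord: "continuous_map X euclideanreal (\<lambda>f. f i powr \<beta>)" if "i < N" for i
  proof -
    have "continuous_map X euclideanreal (\<lambda>f. f i)"
      unfolding X_def Euclidean_space_def
      by (intro continuous_map_from_subtopology continuous_map_product_projection) simp
    moreover have "f i \<ge> 0" if "f \<in> topspace X" for f
      using that \<open>i < N\<close> by (auto simp: X_def Omega_def)
    ultimately have "continuous_map X (top_of_set {0..}) (\<lambda>f. f i)"
      by (auto simp: continuous_map_in_subtopology)
    moreover have "continuous_map (top_of_set {0..}) euclideanreal (\<lambda>x. x powr \<beta>)"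
      unfolding continuous_map_iff_continuous
      by (rule continuous_on_powr'[OF continuous_on_id continuous_on_const]) (use assms in simp)
    ultimately have "continuous_map X euclideanreal ((\<lambda>x. x powr \<beta>) \<circ> (\<lambda>f. f i))"
      by (rule continuous_map_compose)
    then show ?thesis by (simp add: o_def)
  qed
  have "continuous_map X euclideanreal
          (\<lambda>f. 1 / (1 - 2 powr (1 - \<beta>)) * (1 - (\<Sum>i<N. f i powr \<beta>)))"
    using coord
    by (intro continuous_map_real_mult continuous_map_diff continuous_map_sum) auto
  then show ?thesis
    by (simp add: continuous_on_Omega_def daroczy_entropy_def X_def)
qed

lemma power_sum_eq_1_iff:
  assumes "\<beta> > 1" "p \<in> Omega N"
  shows "power_sum \<beta> p = 1 \<longleftrightarrow> (\<exists>k<N. p ! k = 1)"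
proof
  assume "power_sum \<beta> p = 1"
  then have "\<forall>x\<in>set p. x = 0 \<or> x = 1"
    using power_sum_eq_sum_list_imp_01[of \<beta> p] Omega_bounds[OF assms(2)] assms
    by (simp add: Omega_def)
  moreover have "\<not> (\<forall>x\<in>set p. x = 0)"
  proof
    assume "\<forall>x\<in>set p. x = 0"
    then have "sum_list p = 0" by (induction p) auto
    with assms(2) show False by (simp add: Omega_def)
  qed
  ultimately have "1 \<in> set p" by auto
  then show "\<exists>k<N. p ! k = 1"
    using assms(2) by (auto simp: in_set_conv_nth Omega_def)
next
  assume "\<exists>k<N. p ! k = 1"
  then have "1 \<in> set p"
    using assms(2) by (auto simp: in_set_conv_nth Omega_def)
  then have "1 powr \<beta> \<in> set (map (\<lambda>x. x powr \<beta>) p)"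
    unfolding set_map by (rule imageI)
  then have "1 powr \<beta> \<le> power_sum \<beta> p"
    unfolding power_sum_def by (intro member_le_sum_list_nonneg) auto
  moreover have "power_sum \<beta> p \<le> 1"
    using power_sum_le_sum_list[of \<beta> p] Omega_bounds[OF assms(2)] assms
    by (simp add: Omega_def)
  ultimately show "power_sum \<beta> p = 1" by simp
qed

lemma daroczy_symmetric:
  assumes "\<pi> permutes {..<length p}"
  shows "daroczy_entropy \<beta> (permute_list \<pi> p) = daroczy_entropy \<beta> p"
proof -
  have "mset (map (\<lambda>x. x powr \<beta>) (permute_list \<pi> p)) = mset (map (\<lambda>x. x powr \<beta>) p)"
    using assms by simp
  then show ?thesis
    unfolding daroczy_entropy_power_sum power_sum_def by (metis sum_mset_sum_list)
qed

text \<open>Only the replaced entry contributes to the change of the power sum, whatever the remaining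
  entries are.\<close>

lemma daroczy_refinement_diff:
  assumes "n < length p"
  shows "daroczy_entropy \<beta> (take n p @ q @ drop (Suc n) p) - daroczy_entropy \<beta> p
       = 1 / (1 - 2 powr (1 - \<beta>)) * (p ! n powr \<beta> - power_sum \<beta> q)"
proof -
  have "power_sum \<beta> p = power_sum \<beta> (take n p @ p ! n # drop (Suc n) p)"
    by (rule arg_cong[OF id_take_nth_drop[OF assms], of "power_sum \<beta>"])
  then have "1 - power_sum \<beta> (take n p @ q @ drop (Suc n) p) - (1 - power_sum \<beta> p)
           = p ! n powr \<beta> - power_sum \<beta> q"
    unfolding power_sum_append power_sum_Cons by linarith
  then show ?thesis
    unfolding daroczy_entropy_power_sum by (simp only: right_diff_distrib[symmetric])
qed

lemma daroczy_increasing: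
  assumes \<beta>: "\<beta> > 1" and p: "p \<in> Omega N" and n: "n < N"
    and q: "\<forall>x\<in>set q. 0 \<le> x" and split: "p ! n = sum_list q"
  defines "d \<equiv> daroczy_entropy \<beta> (take n p @ q @ drop (Suc n) p) - daroczy_entropy \<beta> p"
  shows "0 \<le> d \<and> d \<le> (if p ! n = 0 then 0
                       else p ! n * daroczy_entropy \<beta> (map (\<lambda>x. x / p ! n) q))"
proof -
  define C where "C = 1 / (1 - 2 powr (1 - \<beta>))"
  define r where "r = p ! n"
  have C: "C > 0" unfolding C_def using daroczy_factor_pos[OF \<beta>] .
  have len: "n < length p" using p n by (simp add: Omega_def)
  have r: "0 \<le> r" "r \<le> 1"
    using Omega_bounds[OF p] len by (auto simp: r_def)
  have d: "d = C * (r powr \<beta> - power_sum \<beta> q)"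
    unfolding d_def C_def r_def by (rule daroczy_refinement_diff[OF len])
  show ?thesis
  proof (cases "r = 0")
    case True
    have "\<forall>x\<in>set q. x = 0"
      using q member_le_sum_list_nonneg[OF q] split True by (force simp: r_def)
    then have "power_sum \<beta> q = 0"
      by (induction q) (auto simp: power_sum_def)
    with d True show ?thesis by (simp add: r_def)
  next
    case False
    define s where "s = 1 - power_sum \<beta> (map (\<lambda>x. x / r) q)"
    have "r > 0" using r False by simp
    have s: "s \<ge> 0"
      using power_sum_normalized_le_1[of \<beta> q] \<beta> q split \<open>r > 0\<close> by (simp add: s_def r_def)
    have d': "d = C * (r powr \<beta> * s)"
      using d power_sum_scale[OF \<open>r > 0\<close> q] by (simp add: s_def right_diff_distrib)
    have "d \<le> C * (r * s)"
      unfolding d' using C s r \<beta> by (intro mult_left_mono mult_right_mono powr_le_self) auto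
    moreover have "0 \<le> d"
      unfolding d' using C s by simp
    ultimately show ?thesis
      using False by (simp add: daroczy_entropy_power_sum C_def r_def s_def)
  qed
qed

lemma daroczy_maximum:
  assumes "\<beta> > 1" "N \<ge> 1" "p \<in> Omega N"
  shows "daroczy_entropy \<beta> p \<le> daroczy_entropy \<beta> (replicate N (1 / real N))"
proof -
  have "power_sum \<beta> (replicate N (1 / real N)) = (1 / real N) powr \<beta> * real N"
    by (simp add: power_sum_def sum_list_replicate)
  also have "\<dots> \<le> power_sum \<beta> p"
    using power_sum_tangent_bound[of \<beta> "1 / real N" p] assms by (simp add: Omega_def)
  finally show ?thesis
    unfolding daroczy_entropy_power_sum
    using daroczy_factor_pos[OF assms(1)] by (intro mult_left_mono) auto
qed

theorem mainTheorem6: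
  fixes \<beta> :: real
  assumes "\<beta> > 1"
  shows "upper_entropy_function (daroczy_entropy \<beta>)"
proof -
  have "daroczy_entropy \<beta> p = 0 \<longleftrightarrow> (\<exists>k<N. p ! k = 1)" if "p \<in> Omega N" for p N
    using power_sum_eq_1_iff[OF assms that] daroczy_factor_pos[OF assms]
    by (auto simp: daroczy_entropy_power_sum)
  then have "entropy_continuity (daroczy_entropy \<beta>)"
    using daroczy_continuous[of \<beta>] assms by (simp add: entropy_continuity_def)
  moreover have "entropy_symmetry (daroczy_entropy \<beta>)"
    using daroczy_symmetric by (auto simp: entropy_symmetry_def Omega_def)
  moreover have "entropy_increasing (daroczy_entropy \<beta>)"
    unfolding entropy_increasing_def using daroczy_increasing[OF assms] by blast
  moreover have "entropy_maximum (daroczy_entropy \<beta>)"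
    unfolding entropy_maximum_def using daroczy_maximum[OF assms] by blast
  ultimately show ?thesis
    by (simp add: upper_entropy_function_def)
qed

end
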